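(* Let $n$ be a squarefree odd positive integer. Then $$\varrho(n)=[\mathbb{Q}(\zeta_n):K_n].$$
   Context: $\varphi$ is Euler's totient function, $\omega(n)$ is the number of distinct prime divisors of $n$, and $\varrho(n):=\varphi(n)/2^{\omega(n)}$. $\mathbb{Q}(\zeta_n)$ is the $n$-th cyclotomic field. For squarefree odd $n=p_1\cdots p_k$ with distinct odd primes $p_i$, put $p_i^*=(-1)^{(p_i-1)/2}p_i$; then $\mathbb{Q}(\sqrt{p_i^*})\subset\mathbb{Q}(\zeta_{p_i})\subset\mathbb{Q}(\zeta_n)$, and $K_n:=\mathbb{Q}(\sqrt{p_1^*},\dots,\sqrt{p_k^*})\subseteq\mathbb{Q}(\zeta_n)$ (the compositum of the quadratic subfields of $\mathbb{Q}(\zeta_n)$). *)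

theory Defs
  imports
    "HOL-Algebra.Algebraic_Closure_Type"
    "HOL-Algebra.Generated_Fields"
    "HOL-Number_Theory.Totient"
    "HOL-Computational_Algebra.Squarefree"
begin

definition omega :: "nat \<Rightarrow> nat" where
  "omega n = card (prime_factors n)"

definition varrho :: "nat \<Rightarrow> real" where
  "varrho n = real (totient n) / 2 ^ omega n"

text \<open>
  All fields below are subfields of the complex numbers; the HOL-Algebra ring carried by a type is
  \<^const>\<open>ring_of_type_algebra\<close>.
\<close>

abbreviation complex_field :: "complex ring" where
  "complex_field \<equiv> ring_of_type_algebra"

definition rat_adjoin :: "complex set \<Rightarrow> complex set" where
  "rat_adjoin S = generate_field complex_field (\<rat> \<union> S)"

definition cyclotomic_field :: "nat \<Rightarrow> complex set" where
  "cyclotomic_field n = rat_adjoin {cis (2 * pi / real n)}"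

text \<open>The subtraction and division on naturals are exact, since this is used only for odd \<open>p\<close>.\<close>

definition prime_star :: "nat \<Rightarrow> int" where
  "prime_star p = (-1) ^ ((p - 1) div 2) * int p"

definition quadratic_compositum :: "nat \<Rightarrow> complex set" where
  "quadratic_compositum n =
     rat_adjoin ((\<lambda>p. csqrt (of_int (prime_star p))) ` prime_factors n)"

text \<open>
  The degree \<open>[L : K]\<close> is \<^term>\<open>ring.dim complex_field K L\<close>. As \<^const>\<open>ring.dim\<close> is a definite
  description, it is meaningful only together with
  \<^term>\<open>ring.finite_dimension complex_field K L\<close>, which also entails \<open>K \<subseteq> L\<close> for subfields
  \<open>K\<close> and \<open>L\<close>.
\<close>

end

theory Submission
  imports Defs
begin

text \<open>
  Write \<open>\<zeta>\<close> for \<open>exp (2 \<pi> i / n)\<close>. The tower \<open>\<rat> \<subseteq> K \<subseteq> \<rat>(\<zeta>)\<close>, with \<open>K\<close> the compositum of the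
  quadratic fields, gives \<open>[\<rat>(\<zeta>) : \<rat>] = [K : \<rat>] \<cdot> [\<rat>(\<zeta>) : K]\<close>, so the claim follows from
  \<open>[\<rat>(\<zeta>) : \<rat>] = \<phi>(n)\<close>, \<open>[K : \<rat>] = 2 ^ \<omega>(n)\<close> and \<open>K \<subseteq> \<rat>(\<zeta>)\<close>.

  \<open>[\<rat>(\<zeta>) : \<rat>] = \<phi>(n)\<close> (\<open>dimension_cyclotomic_field\<close>). Let \<open>f\<close> be the primitive minimal polynomial of
  \<open>\<zeta>\<close> over the integers. Its roots are exactly the \<open>\<zeta> ^ k\<close> with \<open>k\<close> coprime to \<open>n\<close>. That all of these are
  roots is Dedekind's theorem (\<open>root_of_unity_conjugate\<close>), which reduces to prime exponents \<open>p\<close> and is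
  there a consequence of \<open>h(X\<^sup>p) \<equiv> h(X)\<^sup>p\<close> modulo \<open>p\<close>. The argument stays over the integers: where the
  usual one reduces \<open>X\<^sup>n - 1\<close> modulo \<open>p\<close> to a polynomial without double roots, here the derivative
  \<open>n X ^ (n - 1)\<close> is evaluated at a root of unity, and \<open>p\<close> is seen to divide \<open>n\<^sup>p\<close> in \<open>\<int>[\<zeta>]\<close>, hence
  in \<open>\<int>\<close>.

  \<open>[K : \<rat>] = 2 ^ \<omega>(n)\<close> (\<open>dimension_multiquadratic\<close>). The square roots are adjoined one at a time. A
  rational number with a square root in the field obtained so far becomes a rational square after
  multiplication by some of the numbers whose roots have been adjoined
  (\<open>square_in_multiquadratic\<close>). As a nonempty product of distinct primes is not a rational square up to
  sign, each new root doubles the degree.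

  \<open>K \<subseteq> \<rat>(\<zeta>)\<close> (\<open>sqrt_star_mem_cyclotomic_field\<close>). In \<open>p = \<Prod> (1 - \<zeta>\<^sub>p ^ k)\<close>
  over \<open>0 < k < p\<close>, the factors for \<open>k\<close> and \<open>p - k\<close> agree up to the unit \<open>- \<zeta>\<^sub>p ^ (p - k)\<close>, so that
  \<open>p\<close> is \<open>(-1) ^ ((p - 1) / 2)\<close> times a power of \<open>\<zeta>\<^sub>p\<close> times a square; and every power of \<open>\<zeta>\<^sub>p\<close>
  is a square because \<open>p\<close> is odd.
\<close>


section \<open>Integer polynomials evaluated at a ring element\<close>

definition int_eval :: "int poly \<Rightarrow> 'a::comm_ring_1 \<Rightarrow> 'a" where
  "int_eval g z = poly (map_poly of_int g) z"

lemma int_eval_0 [simp]: "int_eval 0 z = 0"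
  by (simp add: int_eval_def)

lemma int_eval_pCons [simp]: "int_eval (pCons a g) z = of_int a + z * int_eval g z"
  by (cases "pCons a g = 0") (auto simp: int_eval_def map_poly_pCons)

lemma int_eval_1 [simp]: "int_eval 1 z = 1"
  by (simp add: one_pCons)

lemma int_eval_add [simp]: "int_eval (g + h) z = int_eval g z + int_eval h z"
  by (induction g h rule: poly_induct2) (auto simp: algebra_simps)

lemma int_eval_smult [simp]: "int_eval (smult c g) z = of_int c * int_eval g z"
  by (induction g) (auto simp: algebra_simps)

lemma int_eval_minus [simp]: "int_eval (- g) z = - int_eval g z"
  by (induction g) (auto simp: algebra_simps)

lemma int_eval_diff [simp]: "int_eval (g - h) z = int_eval g z - int_eval h z"
  using int_eval_add[of g "- h" z] by simp

lemma int_eval_mult [simp]: "int_eval (g * h) z = int_eval g z * int_eval h z"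
  by (induction g) (auto simp: algebra_simps)

lemma int_eval_power [simp]: "int_eval (g ^ k) z = int_eval g z ^ k"
  by (induction k) auto

lemma int_eval_of_nat [simp]: "int_eval (of_nat k) z = of_nat k"
  by (induction k) auto

lemma int_eval_monom [simp]: "int_eval (Polynomial.monom c k) z = of_int c * z ^ k"
  by (induction k) (auto simp: monom_Suc algebra_simps monom_0)

lemma int_eval_pcompose [simp]: "int_eval (pcompose g h) z = int_eval g (int_eval h z)"
  by (induction g) (auto simp: pcompose_pCons)

section \<open>Minimal polynomials over the integers\<close>

text \<open>
  By Gauss's lemma the content of the cofactor of \<open>f\<close> in \<open>c g\<close> is divisible by \<open>c\<close>, so \<open>c\<close> can be cancelled.
\<close>

lemma content_1_dvd_cancel:
  fixes f g :: "int poly"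
  assumes "content f = 1" "f dvd smult c g" "c \<noteq> 0"
  shows "f dvd g"
proof -
  obtain q where q: "smult c g = f * q" using assms(2) by blast
  have "content (smult c g) = content q" unfolding q using assms(1) by (simp add: content_mult)
  then have "c dvd content q" by (metis content_smult dvd_mult2 normalize_dvd_iff dvd_refl)
  then have "[:c:] dvd q" by (simp add: const_poly_dvd_iff_dvd_content)
  then obtain q' where "q = smult c q'" by (auto elim!: dvdE)
  then have "smult c g = smult c (f * q')" using q by simp
  then have "g = f * q'" using assms(3) by (metis smult_cancel)
  then show ?thesis by simp
qed

text \<open>
  The vanishing ideal of \<open>z\<close> in \<open>\<int>[X]\<close> is principal: its generator is the primitive part of a nonzero
  element of least degree. Pseudo-division shows that it divides every element up to an integer
  factor, and that factor cancels by primitivity.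
\<close>

lemma ex_primitive_int_minpoly:
  fixes z :: "'a::{idom,ring_char_0}"
  assumes "g0 \<noteq> 0" "int_eval g0 z = 0"
  obtains f where "f \<noteq> 0" "\<And>g. int_eval g z = 0 \<longleftrightarrow> f dvd g"
proof -
  define f1 where "f1 = arg_min Polynomial.degree (\<lambda>g. g \<noteq> 0 \<and> int_eval g z = 0)"
  have f1: "f1 \<noteq> 0" "int_eval f1 z = 0"
    using arg_min_natI[of "\<lambda>g. g \<noteq> 0 \<and> int_eval g z = 0" g0 Polynomial.degree] assms
    by (auto simp: f1_def)
  have min: "Polynomial.degree f1 \<le> Polynomial.degree g" if "g \<noteq> 0" "int_eval g z = 0" for g
    using arg_min_nat_le[of "\<lambda>g. g \<noteq> 0 \<and> int_eval g z = 0" g Polynomial.degree] that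
    by (auto simp: f1_def)
  define f where "f = primitive_part f1"
  have cf: "content f = 1" using f1 by (simp add: f_def)
  have f0: "f \<noteq> 0" using f1 by (simp add: f_def)
  have deg: "Polynomial.degree f = Polynomial.degree f1" by (simp add: f_def)
  have "f1 = smult (content f1) f" by (simp add: f_def)
  then have "of_int (content f1) * int_eval f z = 0" using f1(2) by (metis int_eval_smult)
  then have fz: "int_eval f z = 0" using f1(1) by simp
  have "f dvd g" if g: "int_eval g z = 0" for g
  proof -
    obtain a q where aq: "a \<noteq> 0" "smult a g = f * q + pseudo_mod g f"
      using pseudo_mod(1)[OF f0] by blast
    have "int_eval (pseudo_mod g f) z = int_eval (smult a g - f * q) z"
      using aq(2) by simp
    also have "\<dots> = 0" by (simp add: g fz)
    finally have "pseudo_mod g f = 0"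
      using pseudo_mod(2)[OF f0, of g] min[of "pseudo_mod g f"] deg by fastforce
    then show ?thesis using aq content_1_dvd_cancel[OF cf] by (metis add.right_neutral dvd_triv_left)
  qed
  then have "int_eval g z = 0 \<longleftrightarrow> f dvd g" for g using fz by (auto elim!: dvdE)
  then show thesis using that[OF f0] by blast
qed

lemma ex_monic_int_minpoly:
  fixes z :: "'a::{idom,ring_char_0}"
  assumes "Polynomial.lead_coeff g0 = 1" "int_eval g0 z = 0"
  obtains f where "Polynomial.lead_coeff f = 1" "\<And>g. int_eval g z = 0 \<longleftrightarrow> f dvd g"
proof -
  have "g0 \<noteq> 0" using assms(1) by auto
  then obtain f where f: "f \<noteq> 0" "\<And>g. int_eval g z = 0 \<longleftrightarrow> f dvd g"
    using ex_primitive_int_minpoly assms(2) by metis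
  then obtain q where "g0 = f * q" using assms(2) by blast
  then have "Polynomial.lead_coeff f * Polynomial.lead_coeff q = 1"
    using assms(1) by (simp add: lead_coeff_mult)
  then consider "Polynomial.lead_coeff f = 1" | "Polynomial.lead_coeff f = -1"
    using pos_zmult_eq_1_iff_lemma by blast
  then show thesis
  proof cases
    case 1 then show ?thesis using that f by blast
  next
    case 2 then show ?thesis using that[of "- f"] f by simp
  qed
qed

text \<open>
  Division with remainder by a monic polynomial stays within the integers. This makes every element
  of \<open>\<int>[z]\<close>, for an algebraic integer \<open>z\<close>, a value at \<open>z\<close> of a polynomial of degree below that of the
  minimal polynomial.
\<close>

lemma monic_reduce:
  fixes f t :: "int poly"
  assumes "Polynomial.lead_coeff f = 1"
  obtains q v where "t = f * q + v" "v = 0 \<or> Polynomial.degree v < Polynomial.degree f"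
proof -
  have f0: "f \<noteq> 0" using assms by auto
  obtain q v where "pseudo_divmod t f = (q, v)" by fastforce
  from pseudo_divmod[OF f0 this] show thesis using that[of q v] assms by simp
qed

section \<open>The Frobenius congruence\<close>

lemma prime_dvd_freshman:
  fixes x y :: "'a::comm_ring_1"
  assumes p: "normalization_semidom_class.prime (p::nat)"
  shows "of_nat p dvd (x + y) ^ p - (x ^ p + y ^ p)"
proof -
  have p0: "p > 0" using p prime_gt_0_nat by blast
  have "(x + y) ^ p = (\<Sum>k\<le>p. of_nat (p choose k) * x ^ k * y ^ (p - k))"
    by (rule binomial_ring)
  also have "{..p} = insert 0 (insert p {0<..<p})" using p0 by auto
  also have "(\<Sum>k\<in>insert 0 (insert p {0<..<p}). of_nat (p choose k) * x ^ k * y ^ (p - k)) =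
     y ^ p + (x ^ p + (\<Sum>k\<in>{0<..<p}. of_nat (p choose k) * x ^ k * y ^ (p - k)))"
    using p0 by (subst sum.insert; simp)+
  finally have "(x + y) ^ p - (x ^ p + y ^ p) =
      (\<Sum>k\<in>{0<..<p}. of_nat (p choose k) * x ^ k * y ^ (p - k))" by simp
  moreover have "of_nat p dvd \<dots>"
  proof (intro dvd_sum dvd_mult2)
    fix k assume "k \<in> {0<..<p}"
    then have "p dvd p choose k" using dvd_choose_prime[of k p] p by auto
    then show "of_nat p dvd (of_nat (p choose k) :: 'a)" by (metis dvd_def of_nat_mult)
  qed
  ultimately show ?thesis by simp
qed

lemma fermat_int:
  assumes p: "normalization_semidom_class.prime (p::nat)"
  shows "int p dvd a - a ^ p"
proof -
  have p0: "p > 0" using p prime_gt_0_nat by blast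
  have nat: "int p dvd int k - int k ^ p" for k
  proof (induction k)
    case 0 show ?case using p0 by (simp add: zero_power)
  next
    case (Suc k)
    have "int p dvd (int k - int k ^ p) - ((int k + 1) ^ p - (int k ^ p + 1 ^ p))"
      by (rule dvd_diff[OF Suc prime_dvd_freshman[OF p]])
    also have "\<dots> = int (Suc k) - int (Suc k) ^ p" by (simp add: algebra_simps)
    finally show ?case .
  qed
  \<comment> \<open>every integer is congruent to a natural number\<close>
  define k where "k = nat (a mod int p)"
  have "[int k = a] (mod int p)" using p0 by (simp add: k_def cong_def)
  then have "[int k - int k ^ p = a - a ^ p] (mod int p)" by (intro cong_diff cong_pow)
  then show ?thesis using nat[of k] cong_dvd_iff by blast
qed

text \<open>
  Both \<open>g(X) \<mapsto> g(X\<^sup>p)\<close> and, modulo \<open>p\<close>, \<open>g \<mapsto> g\<^sup>p\<close> are ring homomorphisms. They agree on \<open>X\<close> and, by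
  Fermat's little theorem, on constants modulo \<open>p\<close>.
\<close>

lemma frobenius_mod_prime:
  fixes g :: "int poly"
  assumes p: "normalization_semidom_class.prime (p::nat)"
  shows "of_nat p dvd pcompose g (Polynomial.monom 1 p) - g ^ p"
proof (induction g)
  case 0 show ?case using prime_gt_0_nat[OF p] by (simp add: zero_power)
next
  case (pCons a g)
  let ?X = "Polynomial.monom (1::int) 1" and ?P = "of_nat p :: int poly"
  have e: "pCons a g = [:a:] + ?X * g" by (simp add: monom_altdef)
  have Xp: "?X ^ p = Polynomial.monom 1 p" by (simp add: monom_power)
  have "?P dvd [:a:] - [:a:] ^ p"
  proof -
    have "[:a:] - [:a:] ^ p = [:a - a ^ p:]" by (simp add: poly_const_pow)
    moreover obtain c where "a - a ^ p = int p * c" using fermat_int[OF p] by blast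
    ultimately have "[:a:] - [:a:] ^ p = ?P * [:c:]" by (simp add: of_nat_poly)
    then show ?thesis by (metis dvd_triv_left)
  qed
  moreover have "?P dvd ?X ^ p * (pcompose g (Polynomial.monom 1 p) - g ^ p)"
    using pCons.IH by simp
  moreover have "?P dvd ([:a:] + ?X * g) ^ p - ([:a:] ^ p + (?X * g) ^ p)"
    by (rule prime_dvd_freshman[OF p])
  ultimately have "?P dvd ([:a:] - [:a:] ^ p) + ?X ^ p * (pcompose g (Polynomial.monom 1 p) - g ^ p)
      - (([:a:] + ?X * g) ^ p - ([:a:] ^ p + (?X * g) ^ p))"
    using dvd_add dvd_diff by blast
  also have "\<dots> = pcompose (pCons a g) (Polynomial.monom 1 p) - (pCons a g) ^ p"
  proof -
    have "pcompose (pCons a g) (Polynomial.monom 1 p) = [:a:] + ?X ^ p * pcompose g (Polynomial.monom 1 p)"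
      unfolding Xp by (simp add: pcompose_pCons)
    then show ?thesis unfolding e power_mult_distrib by (simp only: algebra_simps)
  qed
  finally show ?case .
qed

section \<open>Conjugates of roots of unity\<close>

lemma map_poly_pderiv_of_int:
  "map_poly of_int (pderiv g) = (pderiv (map_poly of_int g) :: 'a::{idom,ring_char_0} poly)"
  by (rule poly_eqI) (simp add: coeff_pderiv coeff_map_poly)

lemma pderiv_root_of_unity_poly:
  "pderiv (Polynomial.monom 1 n - 1 :: int poly) = smult (int n) (Polynomial.monom 1 (n - 1))"
  by (simp add: pderiv_diff pderiv_monom smult_monom)

text \<open>
  Let \<open>f\<close> be the minimal polynomial of \<open>z\<close> and \<open>X\<^sup>n - 1 = f h\<close>. If \<open>f(z\<^sup>p) \<noteq> 0\<close>, then \<open>h(z\<^sup>p) = 0\<close>, and the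
  Frobenius congruence makes \<open>h(z)\<^sup>p\<close> a multiple of \<open>p\<close> in \<open>\<int>[z]\<close>. Since \<open>n z ^ (n - 1) = f'(z) h(z)\<close>, so
  is \<open>n\<^sup>p\<close>. As \<open>1, z, \<dots>, z ^ (deg f - 1)\<close> is a basis of \<open>\<int>[z]\<close> over \<open>\<int>\<close>, the prime \<open>p\<close> divides \<open>n\<^sup>p\<close>
  already in \<open>\<int>\<close>, which contradicts \<open>\<not> p dvd n\<close>.
\<close>

lemma root_of_unity_conjugate_prime:
  fixes z :: "'a::{idom,ring_char_0}"
  assumes z: "z ^ n = 1" and p: "normalization_semidom_class.prime p" "\<not> p dvd n"
    and g: "int_eval g z = 0"
  shows "int_eval g (z ^ p) = 0"
proof -
  let ?U = "Polynomial.monom 1 n - 1 :: int poly"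
  have n: "n > 0" using p by (cases n) auto
  have "Polynomial.lead_coeff ?U = 1"
  proof -
    have "Polynomial.degree ?U = n"
      using n by (intro antisym degree_diff_le le_degree) (auto simp: degree_monom_le)
    then show ?thesis using n by simp
  qed
  moreover have "int_eval ?U z = 0" using z by simp
  ultimately obtain f where f: "Polynomial.lead_coeff f = 1"
      and f_dvd: "\<And>g. int_eval g z = 0 \<longleftrightarrow> f dvd g"
    using ex_monic_int_minpoly by blast
  have fz: "int_eval f z = 0" using f_dvd by simp
  have f_deg: "Polynomial.degree f > 0"
  proof (rule ccontr)
    assume "\<not> Polynomial.degree f > 0"
    then have "f = 1" using f by (metis degree_eq_zeroE gr0I lead_coeff_pCons(2) one_pCons)
    with fz show False by simp
  qed
  have "f dvd ?U" using f_dvd[of ?U] z by simp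
  then obtain h where h: "?U = f * h" by blast
  have "int_eval f (z ^ p) = 0"
  proof (rule ccontr)
    assume nz: "int_eval f (z ^ p) \<noteq> 0"
    have "int_eval f (z ^ p) * int_eval h (z ^ p) = int_eval ?U (z ^ p)"
      unfolding h by simp
    also have "\<dots> = 0" using z by (simp flip: power_mult add: mult.commute) (simp add: power_mult)
    finally have hzp: "int_eval h (z ^ p) = 0" using nz by simp
    obtain r where r: "pcompose h (Polynomial.monom 1 p) - h ^ p = of_nat p * r"
      using frobenius_mod_prime[OF p(1)] by blast
    have "int_eval (pcompose h (Polynomial.monom 1 p) - h ^ p) z = int_eval (of_nat p * r) z"
      by (simp only: r)
    then have hz: "int_eval h z ^ p = - (of_nat p * int_eval r z)"
      using hzp by (simp, metis minus_minus)
    \<comment> \<open>differentiating \<open>X\<^sup>n - 1 = f h\<close> at the root \<open>z\<close> of \<open>f\<close> shows that \<open>h(z)\<close> divides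
      \<open>n z ^ (n - 1)\<close>\<close>
    have "pderiv ?U = f * pderiv h + h * pderiv f" unfolding h by (rule pderiv_mult)
    moreover note pderiv_root_of_unity_poly[of n]
    ultimately have "of_nat n * z ^ (n - 1) = int_eval h z * int_eval (pderiv f) z"
      using fz by (metis add.left_neutral int_eval_add int_eval_monom int_eval_mult int_eval_smult
          mult_1 mult_zero_left of_int_1 of_int_of_nat_eq)
    then have "(of_nat n * z ^ (n - 1)) ^ p * z ^ p
        = - (of_nat p * int_eval r z) * int_eval (pderiv f) z ^ p * z ^ p"
      by (simp add: power_mult_distrib hz)
    moreover have "(of_nat n * z ^ (n - 1)) ^ p * z ^ p = of_nat n ^ p"
    proof -
      have "(z ^ (n - 1)) ^ p * z ^ p = (z ^ (n - 1) * z) ^ p" by (simp add: power_mult_distrib)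
      also have "z ^ (n - 1) * z = 1" using n z by (simp flip: power_Suc2)
      finally show ?thesis by (simp add: power_mult_distrib mult.assoc)
    qed
    moreover define t where "t = - r * pderiv f ^ p * Polynomial.monom 1 p"
    ultimately have tz: "of_nat n ^ p = of_nat p * int_eval t z" by (simp add: mult.assoc)
    \<comment> \<open>\<open>w\<close> vanishes at \<open>z\<close> and has too small a degree, so its constant coefficient is zero\<close>
    obtain q v where qv: "t = f * q + v" "v = 0 \<or> Polynomial.degree v < Polynomial.degree f"
      using monic_reduce[OF f] by blast
    define w where "w = [:int n ^ p:] - smult (int p) v"
    have "int_eval w z = 0" using tz by (simp add: w_def qv fz)
    then have "f dvd w" using f_dvd by blast
    moreover have "Polynomial.degree w < Polynomial.degree f"
      unfolding w_def using qv(2) f_deg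
      by (intro degree_diff_less) (auto intro: le_less_trans[OF degree_smult_le])
    ultimately have "w = 0" by (metis dvd_imp_degree_le not_less)
    then have "poly.coeff w 0 = 0" by simp
    then have "int n ^ p = int p * poly.coeff v 0" by (simp add: w_def)
    then have "int p dvd int (n ^ p)" by simp
    then have "p dvd n ^ p" by (simp only: int_dvd_int_iff)
    then show False using p by (meson prime_dvd_power)
  qed
  moreover have "f dvd g" using f_dvd g by blast
  ultimately show ?thesis by (auto elim!: dvdE)
qed

text \<open>
  Every exponent coprime to \<open>n\<close> is reached by raising to one prime after another; each
  intermediate value is again an \<open>n\<close>-th root of unity at which \<open>g\<close> vanishes.
\<close>

lemma root_of_unity_conjugate:
  fixes z :: "'a::{idom,ring_char_0}"
  assumes "z ^ n = 1" "coprime k n" "int_eval g z = 0"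
  shows "int_eval g (z ^ k) = 0"
  using assms
proof (induction k arbitrary: z rule: less_induct)
  case (less k)
  show ?case
  proof (cases "k = 0 \<or> k = 1")
    case True then show ?thesis using less.prems by auto
  next
    case False
    then obtain p m where pm: "normalization_semidom_class.prime p" "k = p * m"
      by (metis One_nat_def dvdE prime_factor_nat)
    have "int_eval g ((z ^ p) ^ m) = 0"
    proof (rule less.IH)
      show "m < k" using pm False prime_gt_1_nat[OF pm(1)] by simp
      show "(z ^ p) ^ n = 1" using less.prems(1) by (metis power_mult mult.commute power_one)
      show "coprime m n" using less.prems(2) pm by simp
      have "\<not> p dvd n"
        using less.prems(2) pm by (metis coprime_mult_left_iff coprime_absorb_left not_prime_unit)
      then show "int_eval g (z ^ p) = 0"
        using root_of_unity_conjugate_prime[OF less.prems(1) pm(1)] less.prems(3) by blast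
    qed
    then show ?thesis by (simp add: pm(2) power_mult)
  qed
qed


section \<open>The degree of the minimal polynomial of a primitive root of unity\<close>

definition zeta :: "nat \<Rightarrow> complex" where
  "zeta n = cis (2 * pi / real n)"

lemma zeta_power: "zeta n ^ k = cis (2 * pi * real k / real n)"
  by (simp add: zeta_def DeMoivre mult_ac)

lemma power_mod_root_of_unity:
  fixes z :: "'a::monoid_mult"
  assumes "z ^ n = 1"
  shows "z ^ (k mod n) = z ^ k"
proof -
  have "z ^ k = z ^ (n * (k div n) + k mod n)" by simp
  also have "\<dots> = z ^ (k mod n)" unfolding power_add power_mult using assms by simp
  finally show ?thesis ..
qed

lemma zeta_power_self: "n > 0 \<Longrightarrow> zeta n ^ n = 1"
  by (simp add: zeta_power)

lemma bij_betw_zeta_power: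
  assumes "n > 0"
  shows "bij_betw (\<lambda>k. zeta n ^ k) {..<n} {z. z ^ n = 1}"
  using bij_betw_roots_unity[OF assms] by (simp add: zeta_power)

text \<open>
  The exponents are taken from \<open>1\<close> to \<open>n\<close> here, so that \<^term>\<open>totatives n\<close> is among them for \<open>n = 1\<close> as well.
\<close>

lemma bij_betw_zeta_power_shifted:
  assumes "n > 0"
  shows "bij_betw (\<lambda>k. zeta n ^ k) {0<..n} {z. z ^ n = 1}"
proof -
  have "bij_betw (\<lambda>k. k mod n) {0<..n} {..<n}"
    by (rule bij_betw_byWitness[where f' = "\<lambda>k. if k = 0 then n else k"])
       (use assms in \<open>auto simp: le_less\<close>)
  then have "bij_betw ((\<lambda>k. zeta n ^ k) \<circ> (\<lambda>k. k mod n)) {0<..n} {z. z ^ n = 1}"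
    using bij_betw_zeta_power[OF assms] by (rule bij_betw_trans)
  moreover have "zeta n ^ (k mod n) = zeta n ^ k" for k
    by (rule power_mod_root_of_unity) (rule zeta_power_self[OF assms])
  ultimately show ?thesis by (simp add: o_def)
qed

lemma zeta_power_eq_1_iff:
  assumes "n > 0"
  shows "zeta n ^ k = 1 \<longleftrightarrow> n dvd k"
proof
  assume "n dvd k"
  then show "zeta n ^ k = 1" using zeta_power_self[OF assms] by (auto simp: power_mult)
next
  assume "zeta n ^ k = 1"
  then have "zeta n ^ (k mod n) = zeta n ^ 0"
    by (simp add: power_mod_root_of_unity zeta_power_self[OF assms])
  moreover have "inj_on (\<lambda>k. zeta n ^ k) {..<n}"
    using bij_betw_zeta_power[OF assms] by (simp add: bij_betw_def)
  ultimately have "k mod n = 0"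
    using assms by (auto dest: inj_onD[of _ _ "k mod n" 0])
  then show "n dvd k" by auto
qed

text \<open>
  The polynomial \<open>f\<close> has no double root because \<open>X\<^sup>n - 1\<close> has none, so its degree is the number of its
  roots. These are the primitive roots of unity. On the one hand they are all conjugate to \<open>\<zeta>\<close>. On
  the other hand, if \<open>d < n\<close> divides \<open>n\<close>, then \<open>f\<close> divides \<open>(X\<^sup>n - 1) / (X\<^sup>d - 1)\<close>, since \<open>\<zeta>\<^sup>d \<noteq> 1\<close>, and so no
  root of \<open>f\<close> is a \<open>d\<close>-th root of unity.
\<close>

lemma minpoly_zeta_degree:
  assumes n: "n > 0" and f0: "f \<noteq> 0" and f: "\<And>g. int_eval g (zeta n) = 0 \<longleftrightarrow> f dvd g"
  shows "Polynomial.degree f = totient n"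
proof -
  define F where "F = (map_poly of_int f :: complex poly)"
  have F: "poly F z = int_eval f z" for z by (simp add: F_def int_eval_def)
  have F0: "F \<noteq> 0" using f0 by (auto simp: F_def poly_eq_iff coeff_map_poly)
  have degF: "Polynomial.degree F = Polynomial.degree f"
    unfolding F_def by (rule map_poly_degree_eq) (use f0 in auto)
  let ?U = "Polynomial.monom 1 n - 1 :: int poly"
  have "int_eval ?U (zeta n) = 0" using zeta_power_self[OF n] by simp
  then have "f dvd ?U" using f by blast
  then obtain h where h: "?U = f * h" by blast
  have fU: "z ^ n = 1" if "int_eval f z = 0" for z :: complex
  proof -
    have "int_eval ?U z = 0" unfolding h by (simp add: that)
    then show ?thesis by simp
  qed
  \<comment> \<open>\<open>X\<^sup>n - 1\<close> has no double root, so two factors of it have no common root\<close>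
  have simple: "\<not> (int_eval a z = 0 \<and> int_eval b z = 0)" if "?U = a * b" for a b and z :: complex
  proof
    assume ab: "int_eval a z = 0 \<and> int_eval b z = 0"
    have "pderiv ?U = a * pderiv b + b * pderiv a" unfolding that by (rule pderiv_mult)
    moreover note pderiv_root_of_unity_poly[of n]
    ultimately have "int_eval (smult (int n) (Polynomial.monom 1 (n - 1))) z = 0"
      using ab by simp
    then have "z = 0" using n by simp
    moreover have "int_eval ?U z = 0" unfolding that using ab by simp
    ultimately show False using n by (simp add: zero_power)
  qed
  have "rsquarefree F"
    unfolding rsquarefree_roots
  proof (intro allI notI)
    fix z assume z: "poly F z = 0 \<and> poly (pderiv F) z = 0"
    have "pderiv ?U = f * pderiv h + h * pderiv f" unfolding h by (rule pderiv_mult)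
    moreover note pderiv_root_of_unity_poly[of n]
    moreover have "int_eval (pderiv f) z = 0"
      using z by (simp add: int_eval_def map_poly_pderiv_of_int F_def)
    ultimately have "int_eval (smult (int n) (Polynomial.monom 1 (n - 1))) z = 0"
      using z F by simp
    then have "z = 0" using n by simp
    moreover have "z ^ n = 1" using fU z F by simp
    ultimately show False using n by (simp add: zero_power)
  qed
  then have "F = smult (Polynomial.lead_coeff F) (\<Prod>z|poly F z = 0. [:-z, 1:])"
    by (rule complex_poly_decompose_rsquarefree[symmetric])
  then have "Polynomial.degree F = Polynomial.degree (\<Prod>z|poly F z = 0. [:-z, 1:])"
    using F0 by (metis degree_smult_eq leading_coeff_0_iff)
  also have "\<dots> = card {z. poly F z = 0}"
    by (subst degree_prod_sum_eq) auto
  also have "{z. poly F z = 0} = (\<lambda>k. zeta n ^ k) ` totatives n"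
  proof (intro equalityI subsetI)
    fix w assume "w \<in> (\<lambda>k. zeta n ^ k) ` totatives n"
    then show "w \<in> {z. poly F z = 0}"
      using root_of_unity_conjugate[OF zeta_power_self[OF n]] f[of f]
      by (auto simp: F in_totatives_iff)
  next
    fix w assume "w \<in> {z. poly F z = 0}"
    then have fw: "int_eval f w = 0" by (simp add: F)
    then have "w \<in> {z. z ^ n = 1}" using fU by simp
    then have "w \<in> (\<lambda>k. zeta n ^ k) ` {0<..n}"
      using bij_betw_zeta_power_shifted[OF n] by (simp only: bij_betw_def)
    then obtain k where k: "k \<in> {0<..n}" "w = zeta n ^ k" by blast
    have "coprime k n"
    proof (rule ccontr)
      assume "\<not> coprime k n"
      \<comment> \<open>\<open>d\<close> is the order of \<open>w\<close>\<close>
      define d where "d = n div gcd k n"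
      have dn: "d * gcd k n = n" by (simp add: d_def)
      have d0: "d > 0" using dn n by (cases d) auto
      have dless: "d < n"
        using dn d0 n \<open>\<not> coprime k n\<close>
        by (metis One_nat_def coprime_iff_gcd_eq_1 dvd_triv_left le_neq_implies_less
            mult.right_neutral nat_dvd_not_less nat_mult_eq_cancel1 dvd_imp_le)
      have "n dvd k * d" using dn
        by (metis dvd_refl gcd_dvd1 mult.commute mult_dvd_mono)
      then have wd: "w ^ d = 1"
        using k(2) zeta_power_eq_1_iff[OF n] by (simp flip: power_mult)
      let ?D = "Polynomial.monom 1 d - 1 :: int poly"
      have "?D dvd (Polynomial.monom 1 d) ^ gcd k n - 1 ^ gcd k n"
        unfolding power_diff_sumr2 by simp
      also have "(Polynomial.monom 1 d) ^ gcd k n - 1 ^ gcd k n = ?U"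
        using dn by (simp add: monom_power)
      finally obtain e where e: "?U = ?D * e" by blast
      have "int_eval ?D (zeta n) * int_eval e (zeta n) = int_eval ?U (zeta n)"
        unfolding e by simp
      also have "\<dots> = 0" using zeta_power_self[OF n] by simp
      finally have "int_eval e (zeta n) = 0"
        using zeta_power_eq_1_iff[OF n, of d] dless d0 by (auto dest: dvd_imp_le)
      then have "f dvd e" using f by blast
      then have "int_eval e w = 0" using fw by (auto elim!: dvdE)
      moreover have "int_eval ?D w = 0" using wd by simp
      ultimately show False using simple[OF e] by blast
    qed
    then show "w \<in> (\<lambda>k. zeta n ^ k) ` totatives n" using k by (auto simp: in_totatives_iff)
  qed
  also have "card ((\<lambda>k. zeta n ^ k) ` totatives n) = card (totatives n)"
  proof (rule card_image)
    have "totatives n \<subseteq> {0<..n}" by (auto simp: in_totatives_iff)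
    then show "inj_on (\<lambda>k. zeta n ^ k) (totatives n)"
      using bij_betw_zeta_power_shifted[OF n] by (auto simp: bij_betw_def intro: inj_on_subset)
  qed
  also have "\<dots> = totient n" by (simp add: totient_def)
  finally show ?thesis by (simp add: degF)
qed

section \<open>Subfields of the complex numbers\<close>

lemma field_complex_field: "field complex_field"
  by (rule field_from_type_algebra)

text \<open>
  Simple extensions and their dimensions are developed over a domain; only the generation of
  subfields and the criterion for a subfield ask for a \<^locale>\<open>field\<close>.
\<close>

interpretation CF: domain complex_field
  using field_complex_field by (rule field.axioms)

lemma complex_field_simps [simp]:
  "carrier complex_field = UNIV" "x \<otimes>\<^bsub>complex_field\<^esub> y = x * y"
  "x \<oplus>\<^bsub>complex_field\<^esub> y = x + y" "\<one>\<^bsub>complex_field\<^esub> = 1" "\<zero>\<^bsub>complex_field\<^esub> = 0"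
  by (simp_all add: ring_of_type_algebra_def)

lemma complex_field_a_inv [simp]: "\<ominus>\<^bsub>complex_field\<^esub> x = - x"
  using CF.minus_equality[of "- x" x] by simp

lemma complex_field_m_inv [simp]: "x \<noteq> 0 \<Longrightarrow> inv\<^bsub>complex_field\<^esub> x = inverse x"
  using CF.comm_inv_char[of x "inverse x"] by simp

lemma complex_field_pow [simp]: "x [^]\<^bsub>complex_field\<^esub> (k::nat) = x ^ k"
  by (induction k) auto

lemma complex_subfieldI:
  assumes "1 \<in> K" "\<And>x. x \<in> K \<Longrightarrow> - x \<in> K" "\<And>x y. x \<in> K \<Longrightarrow> y \<in> K \<Longrightarrow> x + y \<in> K"
    "\<And>x y. x \<in> K \<Longrightarrow> y \<in> K \<Longrightarrow> x * y \<in> K" "\<And>x. x \<in> K \<Longrightarrow> inverse x \<in> K"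
  shows "subfield K complex_field"
  using assms by (intro field.subfieldI'[OF field_complex_field] CF.subringI) auto

lemma complex_subfieldD:
  assumes K: "subfield K complex_field"
  shows "0 \<in> K" "1 \<in> K" "x \<in> K \<Longrightarrow> - x \<in> K" "x \<in> K \<Longrightarrow> y \<in> K \<Longrightarrow> x + y \<in> K"
    "x \<in> K \<Longrightarrow> y \<in> K \<Longrightarrow> x - y \<in> K" "x \<in> K \<Longrightarrow> y \<in> K \<Longrightarrow> x * y \<in> K"
    "x \<in> K \<Longrightarrow> inverse x \<in> K" "x \<in> K \<Longrightarrow> y \<in> K \<Longrightarrow> x / y \<in> K" "x \<in> K \<Longrightarrow> x ^ k \<in> K"
proof -
  note R = subringE[OF subfieldE(1)[OF K]]
  show 0: "0 \<in> K" and 1: "1 \<in> K" using R(2,3) by auto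
  show neg: "- x \<in> K" if "x \<in> K" for x using R(5)[of x] that by simp
  show add: "x + y \<in> K" if "x \<in> K" "y \<in> K" for x y using R(7)[of x y] that by simp
  show mult: "x * y \<in> K" if "x \<in> K" "y \<in> K" for x y using R(6)[of x y] that by simp
  show inv: "inverse x \<in> K" if "x \<in> K" for x
    using CF.subfield_m_inv(1)[OF K, of x] that 0 by (cases "x = 0") auto
  show "x - y \<in> K" if "x \<in> K" "y \<in> K" using add[of x "- y"] neg[of y] that by simp
  show "x / y \<in> K" if "x \<in> K" "y \<in> K" using mult[of x "inverse y"] inv[of y] that
    by (simp add: divide_inverse)
  show "x ^ k \<in> K" if "x \<in> K" using that 1 mult by (induction k) auto
qed

lemma complex_subfield_prod:
  assumes "subfield K complex_field" "\<And>i. i \<in> A \<Longrightarrow> f i \<in> K"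
  shows "prod f A \<in> K"
  using assms(2) by (induction A rule: infinite_finite_induct) (auto intro: complex_subfieldD[OF assms(1)])

lemma subfield_Rats: "subfield (\<rat> :: complex set) complex_field"
  by (rule complex_subfieldI) auto

lemma subfield_rat_adjoin: "subfield (rat_adjoin S) complex_field"
  unfolding rat_adjoin_def by (rule field.generate_field_is_subfield[OF field_complex_field]) simp

lemma rat_adjoin_superset: "\<rat> \<union> S \<subseteq> rat_adjoin S"
  unfolding rat_adjoin_def by (auto intro: generate_field.incl)

lemma rat_adjoin_least:
  assumes "subfield K complex_field" "\<rat> \<union> S \<subseteq> K"
  shows "rat_adjoin S \<subseteq> K"
  unfolding rat_adjoin_def using assms by (intro field.generate_field_min_subfield1[OF field_complex_field]) auto

lemma rat_adjoin_empty: "rat_adjoin {} = \<rat>"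
  using rat_adjoin_least[OF subfield_Rats, of "{}"] rat_adjoin_superset[of "{}"] by auto

lemma eval_complex_field: "CF.eval p x = poly (Poly (rev p)) x"
  by (induction p) (auto simp: Poly_append poly_monom Poly_snoc)

text \<open>
  A polynomial is in the algebraic setting the list of its coefficients with the leading one first,
  so it corresponds to the reversed coefficient list of a \<^typ>\<open>complex poly\<close>.
\<close>

lemma rev_coeffs_mem:
  assumes "subfield K complex_field" "\<And>i. poly.coeff q i \<in> K"
  shows "rev (coeffs q) \<in> carrier (univ_poly complex_field K)"
proof -
  have "set (coeffs q) \<subseteq> K" using assms(2) by (auto simp: coeffs_def)
  then show ?thesis
    by (auto simp: univ_poly_def polynomial_def hd_rev last_coeffs_eq_coeff_degree)
qed

lemma complex_field_algebraicI:
  assumes K: "subfield K complex_field" 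
    and p: "\<And>i. poly.coeff p i \<in> K" "p \<noteq> 0" "poly p x = 0"
  shows "(CF.algebraic over K) x"
  using rev_coeffs_mem[OF K p(1)] p(2,3) by (intro CF.algebraicI) (auto simp: eval_complex_field)

lemma rat_adjoin_insert_algebraic:
  assumes alg: "(CF.algebraic over rat_adjoin S) x"
  shows "rat_adjoin (insert x S) = CF.simple_extension (rat_adjoin S) x"
proof
  let ?K = "rat_adjoin S"
  have K: "subfield ?K complex_field" by (rule subfield_rat_adjoin)
  have sf: "subfield (CF.simple_extension ?K x) complex_field"
    using CF.simple_extension_is_subfield[OF K] alg by simp
  have "?K \<subseteq> CF.simple_extension ?K x" by (rule CF.simple_extension_incl) auto
  moreover have "x \<in> CF.simple_extension ?K x"
    using CF.simple_extension_mem[OF subfieldE(1)[OF K]] by simp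
  ultimately show "rat_adjoin (insert x S) \<subseteq> CF.simple_extension ?K x"
    using rat_adjoin_superset[of S] by (intro rat_adjoin_least[OF sf]) auto
  have "?K \<subseteq> rat_adjoin (insert x S)"
    using rat_adjoin_superset[of "insert x S"] by (intro rat_adjoin_least subfield_rat_adjoin) auto
  then show "CF.simple_extension ?K x \<subseteq> rat_adjoin (insert x S)"
    using rat_adjoin_superset[of "insert x S"]
    by (intro CF.simple_extension_subring_incl subfieldE(1)[OF subfield_rat_adjoin]) auto
qed

text \<open>
  The monic irreducible polynomial that determines the dimension of a simple extension divides \<open>p\<close>,
  and it is itself one of the polynomials that \<open>p\<close> is minimal among, so the two degrees agree.
\<close>

lemma dimension_simple_extension_minpoly:
  assumes K: "subfield K complex_field"
    and p: "\<And>i. poly.coeff p i \<in> K" "p \<noteq> 0" "poly p x = 0"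
    and min: "\<And>q. (\<And>i. poly.coeff q i \<in> K) \<Longrightarrow> q \<noteq> 0 \<Longrightarrow> poly q x = 0
      \<Longrightarrow> Polynomial.degree p \<le> Polynomial.degree q"
  shows "CF.dimension (Polynomial.degree p) K (CF.simple_extension K x)"
proof -
  have alg: "(CF.algebraic over K) x" using complex_field_algebraicI[OF K p] .
  define I where "I = CF.Irr K x"
  have I: "I \<in> carrier (univ_poly complex_field K)" "hd I = 1" "CF.eval I x = 0"
    using CF.IrrE[OF K _ alg] by (auto simp: I_def)
  have I0: "I \<noteq> []"
    using CF.IrrE(2)[OF K _ alg] CF.pirreducibleE(1)[OF subfieldE(1)[OF K] I(1)] unfolding I_def by simp
  have "I pdivides\<^bsub>complex_field\<^esub> rev (coeffs p)"
    unfolding I_def using rev_coeffs_mem[OF K p(1)] p(3)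
    by (intro CF.Irr_minimal[OF K _ alg]) (auto simp: eval_complex_field)
  then have "length I - 1 \<le> length (rev (coeffs p)) - 1"
    using CF.pdivides_imp_degree_le[OF subfieldE(1)[OF K] I(1) rev_coeffs_mem[OF K p(1)]] p(2)
    by auto
  then have "length I - 1 \<le> Polynomial.degree p" using p(2) by (simp add: length_coeffs_degree)
  moreover have "Polynomial.degree p \<le> length I - 1"
  proof -
    have sub: "set I \<subseteq> K" using I(1) I0 by (auto simp: univ_poly_def polynomial_def)
    define q where "q = Poly (rev I)"
    have cq: "poly.coeff q i \<in> K" for i
      using sub complex_subfieldD(1)[OF K] nth_mem[of i "rev I"]
      by (auto simp: q_def coeff_Poly_eq nth_default_def simp del: nth_mem)
    have "poly.coeff q (length I - 1) = 1"
      using I0 I(2) by (auto simp: q_def coeff_Poly_eq nth_default_def rev_nth hd_conv_nth)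
    then have q0: "q \<noteq> 0" by auto
    have "Polynomial.degree q \<le> length I - 1"
      by (rule degree_le) (auto simp: q_def coeff_Poly_eq nth_default_def)
    with min[OF cq q0] I(3) show ?thesis by (auto simp: eval_complex_field q_def)
  qed
  ultimately have "length I - 1 = Polynomial.degree p" by simp
  then show ?thesis using CF.dimension_simple_extension[OF K _ alg] by (simp add: I_def)
qed

section \<open>Multiquadratic fields\<close>

text \<open>
  Writing \<open>y = u + v s\<close>, the cross term \<open>2 u v s\<close> of \<open>y\<^sup>2\<close> lies in \<open>K\<close>, whereas \<open>s\<close> does not; hence \<open>u = 0\<close> or
  \<open>v = 0\<close>.
\<close>

lemma square_mem_quadratic_extension:
  assumes K: "subfield K complex_field" and s: "s ^ 2 \<in> K" "s \<notin> K"
    and y: "y \<in> CF.simple_extension K s" "y ^ 2 \<in> K"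
  shows "y \<in> K \<or> (\<exists>v\<in>K. y = v * s)"
proof -
  note D = complex_subfieldD[OF K]
  have "\<exists>u\<in>K. \<exists>v\<in>K. y = u + v * s" using y(1)
  proof (induction rule: CF.simple_extension.induct)
    case zero
    show ?case using D(1) by (intro bexI[of _ 0]) auto
  next
    case (lin k1 k2)
    then obtain u v where uv: "u \<in> K" "v \<in> K" "k1 = u + v * s" by auto
    have "k1 * s + k2 = (v * s ^ 2 + k2) + u * s"
      by (simp add: uv(3) algebra_simps power2_eq_square)
    moreover have "v * s ^ 2 + k2 \<in> K" using D(4)[OF D(6)[OF uv(2) s(1)] lin(2)] .
    ultimately show ?case unfolding complex_field_simps using uv(1) by blast
  qed
  then obtain u v where uv: "u \<in> K" "v \<in> K" "y = u + v * s" by blast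
  have "y ^ 2 - u ^ 2 - v ^ 2 * s ^ 2 = (2 * u * v) * s"
    by (simp add: uv(3) algebra_simps power2_eq_square)
  then have e: "s = (y ^ 2 - u ^ 2 - v ^ 2 * s ^ 2) / (2 * u * v)" if "u \<noteq> 0" "v \<noteq> 0"
    using that by (simp add: field_simps)
  have two: "2 \<in> K" using D(4)[OF D(2) D(2)] by simp
  have "u = 0 \<or> v = 0"
  proof (rule ccontr)
    assume "\<not> ?thesis"
    then have "s = (y ^ 2 - u ^ 2 - v ^ 2 * s ^ 2) / (2 * u * v)" using e by blast
    also have "\<dots> \<in> K"
      using D(8)[OF D(5)[OF D(5)[OF y(2) D(9)[OF uv(1)]] D(6)[OF D(9)[OF uv(2)] s(1)]]
          D(6)[OF D(6)[OF two uv(1)] uv(2)]] .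
    finally show False using s(2) by simp
  qed
  then show ?thesis using uv by auto
qed

lemma algebraic_of_square:
  assumes K: "subfield K complex_field" and s: "s ^ 2 \<in> K"
  shows "(CF.algebraic over K) s"
proof (rule complex_field_algebraicI[OF K, of "[:- (s ^ 2), 0, 1:]"])
  note D = complex_subfieldD[OF K]
  show "poly.coeff [:- (s ^ 2), 0, 1:] i \<in> K" for i
    using D(1,2) D(3)[OF s] by (auto simp: coeff_pCons split: nat.split)
qed (auto simp: power2_eq_square)

lemma dimension_quadratic_extension:
  assumes K: "subfield K complex_field" and s: "s ^ 2 \<in> K" "s \<notin> K"
  shows "CF.dimension 2 K (CF.simple_extension K s)"
proof -
  note D = complex_subfieldD[OF K]
  let ?p = "[:- (s ^ 2), 0, 1:]"
  have "CF.dimension (Polynomial.degree ?p) K (CF.simple_extension K s)"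
  proof (rule dimension_simple_extension_minpoly[OF K])
    show "poly.coeff ?p i \<in> K" for i
      using D(1,2) D(3)[OF s(1)] by (auto simp: coeff_pCons split: nat.split)
    fix q assume q: "\<And>i. poly.coeff q i \<in> K" "q \<noteq> 0" "poly q s = 0"
    show "Polynomial.degree ?p \<le> Polynomial.degree q"
    proof (rule ccontr)
      assume "\<not> ?thesis"
      then have "Polynomial.degree q \<le> 1" by simp
      then have "q = [:poly.coeff q 0, poly.coeff q 1:]"
        by (intro poly_eqI) (auto simp: coeff_pCons coeff_eq_0 split: nat.split)
      then obtain a b where ab: "q = [:a, b:]" by blast
      have "a \<in> K" "b \<in> K" using q(1)[of 0] q(1)[of 1] ab by auto
      moreover have "a + s * b = 0" using q(3) ab by simp
      moreover from this have "b \<noteq> 0" using q(2) ab by auto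
      ultimately have "s = - a / b" by (simp add: field_simps eq_neg_iff_add_eq_0)
      then show False using s(2) D(8)[OF D(3)[OF \<open>a \<in> K\<close>] \<open>b \<in> K\<close>] by simp
    qed
  qed (auto simp: power2_eq_square)
  then show ?thesis by (simp add: numeral_2_eq_2)
qed

abbreviation sqrt_star :: "nat \<Rightarrow> complex" where
  "sqrt_star p \<equiv> csqrt (of_int (prime_star p))"

text \<open>
  A piece of Kummer theory: the rational squares of the multiquadratic field are generated, up to
  squares of rationals, by the numbers whose roots were adjoined. In the induction step either \<open>y\<close>
  lies in the smaller field already, or \<open>y = v \<surd>d\<close> with \<open>v\<close> in the smaller field and \<open>d\<close> the new number, and
  then \<open>v d\<close> is a square root of \<open>c d\<close> in the smaller field.
\<close>

lemma square_in_multiquadratic: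
  assumes "finite S" "c \<in> \<rat>" "y \<in> rat_adjoin (sqrt_star ` S)" "y ^ 2 = c"
  shows "\<exists>T\<subseteq>S. \<exists>r\<in>\<rat>. c * (\<Prod>q\<in>T. of_int (prime_star q)) = r ^ 2"
  using assms
proof (induction S arbitrary: c y rule: finite_induct)
  case empty
  then show ?case by (auto simp: rat_adjoin_empty)
next
  case (insert p S)
  let ?K = "rat_adjoin (sqrt_star ` S)" and ?s = "sqrt_star p"
  have K: "subfield ?K complex_field" by (rule subfield_rat_adjoin)
  have Rats: "\<rat> \<subseteq> ?K" using rat_adjoin_superset by blast
  have s2: "?s ^ 2 \<in> ?K" using Rats by auto
  have y: "y \<in> CF.simple_extension ?K ?s"
    using insert.prems(2) rat_adjoin_insert_algebraic[OF algebraic_of_square[OF K s2]] by simp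
  have "y \<in> ?K \<or> (\<exists>v\<in>?K. y = v * ?s)"
  proof (cases "?s \<in> ?K")
    case True
    then have "CF.simple_extension ?K ?s \<subseteq> ?K"
      by (intro CF.simple_extension_subring_incl subfieldE(1)[OF K]) auto
    then show ?thesis using y by blast
  next
    case False
    then show ?thesis using square_mem_quadratic_extension[OF K s2 _ y] insert.prems Rats by auto
  qed
  then show ?case
  proof
    assume "y \<in> ?K"
    then obtain T r where "T \<subseteq> S" "r \<in> \<rat>" "c * (\<Prod>q\<in>T. of_int (prime_star q)) = r ^ 2"
      using insert.IH[OF insert.prems(1) _ insert.prems(3)] by blast
    then show ?thesis by blast
  next
    assume "\<exists>v\<in>?K. y = v * ?s"
    then obtain v where v: "v \<in> ?K" "y = v * ?s" by blast
    let ?d = "of_int (prime_star p) :: complex"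
    have "v * ?d \<in> ?K" using v(1) Rats by (intro complex_subfieldD[OF K]) auto
    moreover have "(v * ?d) ^ 2 = c * ?d"
    proof -
      have "c = v ^ 2 * ?d" using v(2) insert.prems(3) by (simp only: power_mult_distrib power2_csqrt)
      then show ?thesis by (simp add: power2_eq_square)
    qed
    ultimately obtain T r where T: "T \<subseteq> S" "r \<in> \<rat>" "c * ?d * (\<Prod>q\<in>T. of_int (prime_star q)) = r ^ 2"
      using insert.IH[of "c * ?d" "v * ?d"] insert.prems(1) by auto
    have "p \<notin> T" "finite T" using T(1) insert.hyps by (auto dest: finite_subset)
    then have "c * (\<Prod>q\<in>insert p T. of_int (prime_star q)) = r ^ 2"
      using T(3) by (simp add: mult.assoc)
    then show ?thesis using T by (intro exI[of _ "insert p T"]) auto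
  qed
qed

text \<open>
  The multiplicity of a prime of \<open>T\<close> is odd in the product and even in a square.
\<close>

lemma prod_prime_star_not_rat_square:
  assumes "finite T" "T \<noteq> {}" "\<And>q. q \<in> T \<Longrightarrow> normalization_semidom_class.prime q" "r \<in> \<rat>"
  shows "(\<Prod>q\<in>T. of_int (prime_star q)) \<noteq> (r :: complex) ^ 2"
proof
  assume eq: "(\<Prod>q\<in>T. of_int (prime_star q)) = r ^ 2"
  obtain a b where ab: "b > (0::int)" "r = of_int a / of_int b" using assms(4) by (rule Rats_cases')
  have "of_int ((\<Prod>q\<in>T. prime_star q) * b ^ 2) = (of_int (a ^ 2) :: complex)"
    using eq ab by (simp add: field_simps)
  then have "(\<Prod>q\<in>T. prime_star q) * b ^ 2 = a ^ 2" by (simp only: of_int_eq_iff)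
  then have "\<bar>(\<Prod>q\<in>T. prime_star q) * b ^ 2\<bar> = \<bar>a ^ 2\<bar>" by (rule arg_cong)
  moreover have "\<bar>prime_star q\<bar> = int q" for q
    by (simp add: prime_star_def abs_mult power_abs)
  ultimately have "(\<Prod>q\<in>T. int q) * b ^ 2 = a ^ 2" by (simp add: abs_mult abs_prod)
  then have "int ((\<Prod>q\<in>T. q) * nat \<bar>b\<bar> ^ 2) = int (nat \<bar>a\<bar> ^ 2)" by simp
  then have main: "(\<Prod>q\<in>T. q) * nat \<bar>b\<bar> ^ 2 = nat \<bar>a\<bar> ^ 2" by (simp only: of_nat_eq_iff)
  obtain p where p: "p \<in> T" using assms(2) by blast
  have prp: "normalization_semidom_class.prime p" using p assms(3) by blast
  have pos: "q > 0" if "q \<in> T" for q using assms(3)[OF that] prime_gt_0_nat by blast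
  have P0: "(\<Prod>q\<in>T. q) \<noteq> 0" using pos assms(1) by force
  have "multiplicity p (\<Prod>q\<in>T. q) = 1"
    using multiplicity_prod_prime_powers[of T p "\<lambda>_. 1"] assms p prp by simp
  moreover have "multiplicity p ((\<Prod>q\<in>T. q) * nat \<bar>b\<bar> ^ 2)
      = multiplicity p (\<Prod>q\<in>T. q) + 2 * multiplicity p (nat \<bar>b\<bar>)"
    using P0 ab(1) prp
    by (simp add: prime_elem_multiplicity_mult_distrib prime_elem_multiplicity_power_distrib)
  moreover have "nat \<bar>a\<bar> \<noteq> 0"
  proof
    assume "nat \<bar>a\<bar> = 0"
    then have "(\<Prod>q\<in>T. q) * nat \<bar>b\<bar> ^ 2 = 0" unfolding main by simp
    then show False using P0 ab(1) by simp
  qed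
  moreover from this have "multiplicity p (nat \<bar>a\<bar> ^ 2) = 2 * multiplicity p (nat \<bar>a\<bar>)"
    using prp by (simp add: prime_elem_multiplicity_power_distrib)
  ultimately have "1 + 2 * multiplicity p (nat \<bar>b\<bar>) = 2 * multiplicity p (nat \<bar>a\<bar>)"
    using main by simp
  then show False by presburger
qed

lemma dimension_multiquadratic:
  assumes "finite S" "\<And>q. q \<in> S \<Longrightarrow> normalization_semidom_class.prime q"
  shows "CF.dimension (2 ^ card S) \<rat> (rat_adjoin (sqrt_star ` S))"
  using assms
proof (induction S rule: finite_induct)
  case empty
  show ?case using CF.dimension_one[OF subfield_Rats] by (simp add: rat_adjoin_empty)
next
  case (insert p S)
  let ?K = "rat_adjoin (sqrt_star ` S)" and ?s = "sqrt_star p"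
  have K: "subfield ?K complex_field" by (rule subfield_rat_adjoin)
  have "\<rat> \<subseteq> ?K" using rat_adjoin_superset by blast
  then have s2: "?s ^ 2 \<in> ?K" by auto
  have "?s \<notin> ?K"
  proof
    assume "?s \<in> ?K"
    then obtain T and r :: complex where T: "T \<subseteq> S" "r \<in> \<rat>"
        "of_int (prime_star p) * (\<Prod>q\<in>T. of_int (prime_star q)) = r ^ 2"
      using square_in_multiquadratic[OF insert.hyps(1), of "of_int (prime_star p)" ?s] by auto
    have "finite T" "p \<notin> T" using T(1) insert.hyps by (auto dest: finite_subset)
    then have "(\<Prod>q\<in>insert p T. of_int (prime_star q)) = r ^ 2" using T(3) by simp
    moreover have "(\<Prod>q\<in>insert p T. of_int (prime_star q)) \<noteq> r ^ 2"
      using \<open>finite T\<close> T insert.prems by (intro prod_prime_star_not_rat_square) auto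
    ultimately show False by contradiction
  qed
  then have "CF.dimension 2 ?K (rat_adjoin (insert ?s (sqrt_star ` S)))"
    using dimension_quadratic_extension[OF K s2]
      rat_adjoin_insert_algebraic[OF algebraic_of_square[OF K s2]] by simp
  then have "CF.dimension (2 ^ card S * 2) \<rat> (rat_adjoin (insert ?s (sqrt_star ` S)))"
    using insert.IH insert.prems by (intro CF.telescopic_base[OF subfield_Rats K]) auto
  then show ?case using insert.hyps by (simp add: mult.commute)
qed

section \<open>Square roots in cyclotomic fields\<close>

text \<open>
  Evaluate \<open>1 + X + \<dots> + X ^ (p - 1) = \<Prod> (X - z ^ k)\<close> at \<open>1\<close>. The two sides agree because both are monic
  of degree \<open>p - 1\<close>, so that their difference has a smaller degree but \<open>p - 1\<close> roots. The condition on
  \<open>z\<close> says that it is a primitive \<open>p\<close>-th root of unity.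
\<close>

lemma prod_one_minus_root_of_unity_powers:
  fixes z :: complex
  assumes p: "p > 1" and z: "z ^ p = 1" "inj_on (\<lambda>k. z ^ k) {..<p}"
  shows "of_nat p = (\<Prod>k=1..<p. 1 - z ^ k)"
proof -
  define Q :: "complex poly" where "Q = (\<Sum>i<p. Polynomial.monom 1 i)"
  have Q: "poly Q x = (\<Sum>i<p. x ^ i)" for x by (simp add: Q_def poly_sum poly_monom)
  have cQ: "poly.coeff Q i = (if i < p then 1 else 0)" for i
    by (simp add: Q_def coeff_sum if_distrib sum.delta cong: if_cong)
  have root: "poly Q (z ^ k) = 0" if "k \<in> {1..<p}" for k
  proof -
    have "z ^ k \<noteq> z ^ 0" using inj_onD[OF z(2), of k 0] that by auto
    moreover have "(z ^ k) ^ p = 1" using z(1) by (metis mult.commute power_mult power_one)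
    ultimately show ?thesis unfolding Q by (simp add: sum_gp_strict)
  qed
  define R where "R = (\<Prod>k=1..<p. [:- (z ^ k), 1:])"
  have inj: "inj_on (\<lambda>k. z ^ k) {1..<p}" using z(2) by (rule inj_on_subset) auto
  have dR: "Polynomial.degree R = p - 1" unfolding R_def by (subst degree_prod_sum_eq) auto
  have "Polynomial.lead_coeff R = 1" unfolding R_def by (simp add: lead_coeff_prod)
  then have cR: "poly.coeff R (p - 1) = 1" by (simp add: dR)
  have "Q - R = 0"
  proof (rule ccontr)
    assume nz: "Q - R \<noteq> 0"
    have "(\<lambda>k. z ^ k) ` {1..<p} \<subseteq> {x. poly (Q - R) x = 0}"
    proof
      fix x assume "x \<in> (\<lambda>k. z ^ k) ` {1..<p}"
      then obtain k where k: "k \<in> {1..<p}" "x = z ^ k" by blast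
      then have "poly R x = 0" unfolding R_def poly_prod by (intro prod_zero) auto
      then show "x \<in> {x. poly (Q - R) x = 0}" using root k by simp
    qed
    then have "card ((\<lambda>k. z ^ k) ` {1..<p}) \<le> card {x. poly (Q - R) x = 0}"
      by (intro card_mono poly_roots_finite nz)
    also have "\<dots> \<le> Polynomial.degree (Q - R)" by (rule card_poly_roots_bound) fact
    finally have "p - 1 \<le> Polynomial.degree (Q - R)" unfolding card_image[OF inj] by simp
    moreover have "Polynomial.degree (Q - R) < p - 1"
    proof (rule degree_lessI)
      show "\<forall>k\<ge>p - 1. poly.coeff (Q - R) k = 0"
        using cR cQ p dR by (auto simp: coeff_eq_0 le_less)
    qed (use nz in auto)
    ultimately show False by simp
  qed
  then have "poly Q 1 = poly R 1" by simp
  then show ?thesis by (simp add: Q R_def poly_prod)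
qed

text \<open>
  In \<open>p = \<Prod> (1 - z ^ k)\<close> over \<open>0 < k < p\<close> each factor \<open>1 - z ^ (p - k)\<close> with \<open>2 k < p\<close> equals \<open>- z ^ (p - k) (1 - z ^ k)\<close>.
  The signs combine to the sign of \<^term>\<open>prime_star p\<close>, and what is left is a power of \<open>z\<close> times a
  square.
\<close>

lemma prime_star_is_square:
  fixes z :: complex
  assumes p: "odd p" "p > 1" and z: "z ^ p = 1" "inj_on (\<lambda>k. z ^ k) {..<p}"
  shows "\<exists>e. of_int (prime_star p) = (z ^ e * (\<Prod>k=1..(p-1) div 2. 1 - z ^ k)) ^ 2"
proof -
  define m where "m = (p - 1) div 2"
  have pm: "p = 2 * m + 1" using p by (auto simp: m_def elim: oddE)
  define A where "A = (\<Prod>k=1..m. 1 - z ^ k)"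
  define e where "e = (\<Sum>k=1..m. p - k)"
  have "of_nat p = (\<Prod>k=1..<p. 1 - z ^ k)"
    by (rule prod_one_minus_root_of_unity_powers) fact+
  also have "{1..<p} = {1..m} \<union> {m+1..<p}" using pm by auto
  also have "(\<Prod>k\<in>{1..m} \<union> {m+1..<p}. 1 - z ^ k) = A * (\<Prod>k=m+1..<p. 1 - z ^ k)"
    unfolding A_def by (rule prod.union_disjoint) auto
  also have "(\<Prod>k=m+1..<p. 1 - z ^ k) = (\<Prod>k=1..m. 1 - z ^ (p - k))"
    by (rule prod.reindex_bij_witness[of _ "\<lambda>k. p - k" "\<lambda>k. p - k"]) (use pm in auto)
  also have "\<dots> = (\<Prod>k=1..m. (- 1) * z ^ (p - k) * (1 - z ^ k))"
  proof (rule prod.cong)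
    fix k assume "k \<in> {1..m}"
    then have "z ^ (p - k) * z ^ k = 1" using z(1) pm by (simp flip: power_add)
    then show "1 - z ^ (p - k) = (- 1) * z ^ (p - k) * (1 - z ^ k)" by (simp add: algebra_simps)
  qed simp
  also have "\<dots> = (- 1) ^ m * z ^ e * A"
    by (simp only: prod.distrib A_def e_def power_sum) simp
  finally have "of_nat p = (- 1) ^ m * z ^ e * A ^ 2" by (simp add: power2_eq_square mult_ac)
  moreover have "prime_star p = (- 1) ^ m * int p" by (simp only: prime_star_def m_def)
  moreover have "(- 1) ^ m * (- 1) ^ m = (1 :: complex)" by (simp flip: power_mult_distrib)
  ultimately have "of_int (prime_star p) = z ^ e * A ^ 2" by (simp flip: mult.assoc)
  \<comment> \<open>\<open>m + 1\<close> is the inverse of \<open>2\<close> modulo \<open>p\<close>\<close>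
  also have "z ^ e = (z ^ (e * (m + 1))) ^ 2"
  proof -
    have "z ^ (e * (m + 1) * 2) = z ^ (p * e + e)" using pm by (simp add: algebra_simps)
    also have "\<dots> = z ^ e" by (simp add: power_add power_mult z(1))
    finally show ?thesis by (simp only: power_mult)
  qed
  finally show ?thesis unfolding A_def m_def by (metis power_mult_distrib)
qed

lemma cyclotomic_field_eq: "cyclotomic_field n = rat_adjoin {zeta n}"
  by (simp add: cyclotomic_field_def zeta_def)

lemma zeta_mem_cyclotomic_field: "zeta n \<in> cyclotomic_field n"
  using rat_adjoin_superset by (auto simp: cyclotomic_field_eq)

lemma sqrt_star_mem_cyclotomic_field:
  assumes n: "n > 0" "odd n" and p: "p \<in> prime_factors n"
  shows "sqrt_star p \<in> cyclotomic_field n"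
proof -
  have K: "subfield (cyclotomic_field n) complex_field"
    unfolding cyclotomic_field_def by (rule subfield_rat_adjoin)
  note D = complex_subfieldD[OF K]
  have "normalization_semidom_class.prime p" "p dvd n" using p by (auto simp: prime_factors_dvd)
  then have p1: "p > 1" and "odd p" using n(2) prime_gt_1_nat by (auto dest: dvd_trans)
  have "zeta n ^ (n div p) = zeta p"
    using \<open>p dvd n\<close> n(1) p1 by (simp add: zeta_power) (simp add: zeta_def real_of_nat_div)
  then have zp: "zeta p \<in> cyclotomic_field n" using D(9)[OF zeta_mem_cyclotomic_field] by metis
  have "inj_on (\<lambda>k. zeta p ^ k) {..<p}" "zeta p ^ p = 1"
    using bij_betw_zeta_power[of p] zeta_power_self[of p] p1 by (auto simp: bij_betw_def)
  then obtain e where e: "of_int (prime_star p)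
      = (zeta p ^ e * (\<Prod>k=1..(p-1) div 2. 1 - zeta p ^ k)) ^ 2"
    using prime_star_is_square[OF \<open>odd p\<close> p1] by blast
  let ?w = "zeta p ^ e * (\<Prod>k=1..(p-1) div 2. 1 - zeta p ^ k)"
  have "?w \<in> cyclotomic_field n"
    by (intro D(6) D(9)[OF zp] complex_subfield_prod[OF K] D(5)[OF D(2)])
  moreover have "sqrt_star p ^ 2 = ?w ^ 2" using e by simp
  then have "sqrt_star p = ?w \<or> sqrt_star p = - ?w" by (simp only: power2_eq_iff)
  ultimately show ?thesis using D(3) by metis
qed

section \<open>The degree of a cyclotomic field\<close>

lemma rat_poly_clear_denominators:
  fixes q :: "'a::field_char_0 poly"
  assumes "\<And>i. poly.coeff q i \<in> \<rat>"
  obtains c g where "c \<noteq> (0::int)" "smult (of_int c) q = map_poly of_int g"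
proof -
  have "\<exists>c g. c \<noteq> (0::int) \<and> smult (of_int c) q = map_poly of_int g"
    using assms
  proof (induction q)
    case 0
    show ?case by (rule exI[of _ 1], rule exI[of _ 0]) simp
  next
    case (pCons a q)
    have "poly.coeff q i \<in> \<rat>" for i using pCons.prems[of "Suc i"] by simp
    then obtain c g where cg: "c \<noteq> (0::int)" "smult (of_int c) q = map_poly of_int g"
      using pCons.IH by blast
    have "a \<in> \<rat>" using pCons.prems[of 0] by simp
    then obtain u v where uv: "v \<noteq> (0::int)" "a = of_int u / of_int v"
      by (metis Rats_cases' less_numeral_extra(3) of_int_0_less_iff)
    have "smult (of_int (c * v)) (pCons a q)
        = pCons (of_int (c * u)) (smult (of_int v) (smult (of_int c) q))"
      using uv by (simp add: mult_ac)
    also have "\<dots> = map_poly of_int (pCons (c * u) (smult v g))"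
      by (rule poly_eqI) (simp add: cg(2) coeff_map_poly coeff_pCons split: nat.split)
    finally show ?case using cg(1) uv(1) by (metis mult_eq_0_iff)
  qed
  then show thesis using that by blast
qed

lemma dimension_cyclotomic_field:
  assumes n: "n > 0"
  shows "CF.dimension (totient n) \<rat> (cyclotomic_field n)"
proof -
  let ?U = "Polynomial.monom 1 n - 1 :: int poly"
  have "int_eval ?U (zeta n) = 0" using zeta_power_self[OF n] by simp
  moreover have "?U \<noteq> 0"
  proof
    assume "?U = 0"
    then have "poly.coeff ?U n = 0" by simp
    then show False using n by simp
  qed
  ultimately obtain f where f: "f \<noteq> 0" "\<And>g. int_eval g (zeta n) = 0 \<longleftrightarrow> f dvd g"
    using ex_primitive_int_minpoly by blast
  let ?F = "map_poly of_int f :: complex poly"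
  have degF: "Polynomial.degree ?F = Polynomial.degree f"
    by (rule map_poly_degree_eq) (use f(1) in auto)
  have F: "poly.coeff ?F i \<in> \<rat>" "?F \<noteq> 0" "poly ?F (zeta n) = 0" for i
    using f by (auto simp: coeff_map_poly poly_eq_iff simp flip: int_eval_def)
  have "CF.dimension (Polynomial.degree ?F) \<rat> (CF.simple_extension \<rat> (zeta n))"
  proof (rule dimension_simple_extension_minpoly[OF subfield_Rats F])
    fix q :: "complex poly" assume q: "\<And>i. poly.coeff q i \<in> \<rat>" "q \<noteq> 0" "poly q (zeta n) = 0"
    obtain c g where cg: "c \<noteq> (0::int)" "smult (of_int c) q = map_poly of_int g"
      using rat_poly_clear_denominators[OF q(1)] by blast
    have "int_eval g (zeta n) = 0" by (simp add: int_eval_def q(3) flip: cg(2))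
    then have "f dvd g" using f(2) by blast
    moreover have "g \<noteq> 0" using cg q(2) by auto
    ultimately have "Polynomial.degree f \<le> Polynomial.degree g" by (rule dvd_imp_degree_le)
    also have "Polynomial.degree g = Polynomial.degree (map_poly of_int g :: complex poly)"
      by (rule map_poly_degree_eq[symmetric]) (use \<open>g \<noteq> 0\<close> in auto)
    also have "\<dots> = Polynomial.degree q" using cg(1) by (simp flip: cg(2))
    finally show "Polynomial.degree ?F \<le> Polynomial.degree q" by (simp add: degF)
  qed
  moreover have "(CF.algebraic over \<rat>) (zeta n)" by (rule complex_field_algebraicI[OF subfield_Rats F])
  then have "cyclotomic_field n = CF.simple_extension \<rat> (zeta n)"
    using rat_adjoin_insert_algebraic[of "{}" "zeta n"]
    by (simp add: cyclotomic_field_eq rat_adjoin_empty)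
  ultimately show ?thesis using minpoly_zeta_degree[OF n f] by (simp add: degF)
qed

theorem theorem5p2:
  fixes n :: nat
  assumes "n > 0" and "squarefree n" and "odd n"
  shows "ring.finite_dimension complex_field (quadratic_compositum n) (cyclotomic_field n) \<and>
         varrho n = real (ring.dim complex_field (quadratic_compositum n) (cyclotomic_field n))"
proof -
  let ?K = "quadratic_compositum n" and ?L = "cyclotomic_field n"
  let ?S = "sqrt_star ` prime_factors n"
  have K: "subfield ?K complex_field" and L: "subfield ?L complex_field"
    unfolding quadratic_compositum_def cyclotomic_field_def by (rule subfield_rat_adjoin)+
  have Rats: "\<rat> \<subseteq> ?K"
    unfolding quadratic_compositum_def using rat_adjoin_superset by blast
  have S: "?S \<subseteq> ?L" using sqrt_star_mem_cyclotomic_field assms(1,3) by blast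
  have dimL: "CF.dimension (totient n) \<rat> ?L"
    using dimension_cyclotomic_field assms(1) by blast
  have dimK: "CF.dimension (2 ^ omega n) \<rat> ?K"
    unfolding quadratic_compositum_def omega_def by (rule dimension_multiquadratic) auto
  have "(CF.algebraic over \<rat>) (zeta n)"
    using CF.finite_dimension_imp_algebraic[OF subfield_Rats subfieldE(1)[OF L]]
      CF.finite_dimensionI[OF dimL] zeta_mem_cyclotomic_field by blast
  then have alg: "(CF.algebraic over ?K) (zeta n)" using CF.algebraic_mono[OF Rats] by blast
  have "rat_adjoin (insert (zeta n) ?S) = ?L"
  proof
    show "rat_adjoin (insert (zeta n) ?S) \<subseteq> ?L"
      using S zeta_mem_cyclotomic_field rat_adjoin_superset[of "{zeta n}"]
      by (intro rat_adjoin_least[OF L]) (auto simp: cyclotomic_field_eq)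
    show "?L \<subseteq> rat_adjoin (insert (zeta n) ?S)"
      unfolding cyclotomic_field_eq using rat_adjoin_superset[of "insert (zeta n) ?S"]
      by (intro rat_adjoin_least subfield_rat_adjoin) auto
  qed
  then have "?L = CF.simple_extension ?K (zeta n)"
    using rat_adjoin_insert_algebraic[of ?S "zeta n"] alg by (simp add: quadratic_compositum_def)
  then have fin: "CF.finite_dimension ?K ?L"
    using CF.finite_dimension_simple_extension[OF K] alg by simp
  have "(CF.dim over \<rat>) ?L = (CF.dim over \<rat>) ?K * (CF.dim over ?K) ?L"
    by (rule CF.telescopic_base_dim(2)[OF subfield_Rats K CF.finite_dimensionI[OF dimK] fin])
  then have "totient n = 2 ^ omega n * CF.dim ?K ?L"
    using CF.dimI[OF subfield_Rats dimL] CF.dimI[OF subfield_Rats dimK] by (simp add: over_def)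
  then have "varrho n = real (CF.dim ?K ?L)" by (simp add: varrho_def)
  then show ?thesis using fin by blast
qed

end
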